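(* Let $\mathcal X$ and $\mathcal U$ be sets and let $f:\mathcal X\times\mathcal U\to\mathcal X$ be a function such that: (i) $A_f$ is symmetric, i.e. $(x,y)\in A_f$ if and only if $(y,x)\in A_f$; (ii) $A_f\setminus U_f\subset D$, where $D=\{(x,x):x\in\mathcal X\}$ is the diagonal of $\mathcal X^2$. Let $R_f=\{(x,u)\in\mathcal X\times\mathcal U:(x,f(x,u))\in U_f\}$ and define $g_f:\mathcal X\times\mathcal U\to\mathcal U$ by $$g_f(x,u)=\begin{cases}\sigma(f(x,u),x), & (x,u)\in R_f,\\ u, & \text{otherwise.}\end{cases}$$ Then $(f,g_f)$ is an involution on $\mathcal X\times\mathcal U$. Conversely, if $g:\mathcal X\times\mathcal U\to\mathcal U$ is a function such that $(f,g)$ is an involution on $\mathcal X\times\mathcal U$, then $g|_{R_f}=g_f|_{R_f}$.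
   Context: For a function $f:\mathcal X\times\mathcal U\to\mathcal X$, define the $f$-accessible set and the $f$-uniquely accessible set by $$A_f=\{(x,y)\in\mathcal X^2:\ \exists\,u\in\mathcal U \text{ such that } y=f(x,u)\},$$ $$U_f=\{(x,y)\in A_f:\ \exists!\,u\in\mathcal U\text{ such that } y=f(x,u)\}.$$ For $(x,y)\in U_f$, $\sigma(x,y)$ denotes the unique $u\in\mathcal U$ with $y=f(x,u)$. (Under (i) and (ii) the set $U_f$ is symmetric, so that $\sigma(f(x,u),x)$ is defined for $(x,u)\in R_f$.) The map $(f,g)$ is $(x,u)\mapsto(f(x,u),g(x,u))$. A map $\mathbf H$ of $\mathcal X\times\mathcal U$ to itself is an involution if $\mathbf H\circ\mathbf H$ is the identity. *)

theory Defs
  imports "HOL-Library.FuncSet"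
begin

definition accessible :: "'x set \<Rightarrow> 'u set \<Rightarrow> ('x \<times> 'u \<Rightarrow> 'x) \<Rightarrow> ('x \<times> 'x) set" where
  "accessible X U f = {(x, y) \<in> X \<times> X. \<exists>u\<in>U. y = f (x, u)}"

definition uniquely_accessible ::
    "'x set \<Rightarrow> 'u set \<Rightarrow> ('x \<times> 'u \<Rightarrow> 'x) \<Rightarrow> ('x \<times> 'x) set" where
  "uniquely_accessible X U f = {(x, y) \<in> accessible X U f. \<exists>!u\<in>U. y = f (x, u)}"

(* Only meaningful at pairs (x, y) in uniquely_accessible X U f. *)
definition sigma :: "'u set \<Rightarrow> ('x \<times> 'u \<Rightarrow> 'x) \<Rightarrow> 'x \<Rightarrow> 'x \<Rightarrow> 'u" where
  "sigma U f x y = (THE u. u \<in> U \<and> y = f (x, u))"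

definition regular_set :: "'x set \<Rightarrow> 'u set \<Rightarrow> ('x \<times> 'u \<Rightarrow> 'x) \<Rightarrow> ('x \<times> 'u) set" where
  "regular_set X U f = {(x, u) \<in> X \<times> U. (x, f (x, u)) \<in> uniquely_accessible X U f}"

definition canonical_g :: "'x set \<Rightarrow> 'u set \<Rightarrow> ('x \<times> 'u \<Rightarrow> 'x) \<Rightarrow> 'x \<times> 'u \<Rightarrow> 'u" where
  "canonical_g X U f =
     (\<lambda>(x, u). if (x, u) \<in> regular_set X U f then sigma U f (f (x, u)) x else u)"

(* The first conjunct makes H a self-map of S; values of H outside S are irrelevant. *)
definition involution_on :: "'a set \<Rightarrow> ('a \<Rightarrow> 'a) \<Rightarrow> bool" where
  "involution_on S H \<longleftrightarrow> H \<in> S \<rightarrow> S \<and> (\<forall>p\<in>S. (H \<circ> H) p = p)"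

end

theory Submission
  imports Defs
begin

text \<open>Think of \<open>u\<close> as a label on an arrow from \<open>x\<close> to
  \<open>f (x, u)\<close>. Off the diagonal an accessible pair is uniquely accessible, so symmetry
  passes from \<open>accessible\<close> to \<open>uniquely_accessible\<close>
  (\<open>sym_uniquely_accessible\<close>). Hence if \<open>u\<close> is the only label from
  \<open>x\<close> to \<open>y\<close>, there is exactly one label \<open>v\<close> from
  \<open>y\<close> back to \<open>x\<close>, and the map built from \<open>canonical_g\<close>
  exchanges \<open>(x, u)\<close> and \<open>(y, v)\<close>. At a point that is not regular the
  arrow is a loop at \<open>x\<close>, and keeping \<open>u\<close> makes the point fixed.
  Conversely, every involution with first component \<open>f\<close> must attach to \<open>y\<close>
  some label leading back to \<open>x\<close>; at regular points there is only one.\<close>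

lemma sigma_equality:
  assumes "(x, y) \<in> uniquely_accessible X U f" "u \<in> U" "y = f (x, u)"
  shows "sigma U f x y = u"
  using assms unfolding sigma_def uniquely_accessible_def by (intro the_equality) auto

lemma sigma_works:
  assumes "(x, y) \<in> uniquely_accessible X U f"
  shows "sigma U f x y \<in> U" "f (x, sigma U f x y) = y"
proof -
  obtain u where "u \<in> U" "y = f (x, u)"
    using assms by (auto simp: uniquely_accessible_def)
  then show "sigma U f x y \<in> U" "f (x, sigma U f x y) = y"
    using sigma_equality[OF assms] by auto
qed

text \<open>If a uniquely accessible pair had a reverse that is not, the reverse, still accessible
  by symmetry, would lie on the diagonal. But a diagonal pair is its own reverse.\<close>

lemma sym_uniquely_accessible:
  assumes "sym (accessible X U f)"
    and "accessible X U f - uniquely_accessible X U f \<subseteq> Id_on X"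
  shows "sym (uniquely_accessible X U f)"
proof (rule symI, rule ccontr)
  fix x y
  assume xy: "(x, y) \<in> uniquely_accessible X U f"
    and yx: "(y, x) \<notin> uniquely_accessible X U f"
  have "(y, x) \<in> accessible X U f"
    using xy assms(1) by (auto simp: uniquely_accessible_def dest: symD)
  with yx assms(2) have "x = y" by blast
  with xy yx show False by simp
qed

lemma involution_on_canonical_g:
  assumes f: "f \<in> X \<times> U \<rightarrow> X"
    and sym: "sym (accessible X U f)"
    and diag: "accessible X U f - uniquely_accessible X U f \<subseteq> Id_on X"
  shows "involution_on (X \<times> U) (\<lambda>p. (f p, canonical_g X U f p))"
proof -
  let ?H = "\<lambda>p. (f p, canonical_g X U f p)"
  have "?H (x, u) \<in> X \<times> U \<and> ?H (?H (x, u)) = (x, u)" if x: "x \<in> X" and u: "u \<in> U" for x u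
  proof (cases "(x, u) \<in> regular_set X U f")
    case True
    \<comment> \<open>The point \<open>(y, v)\<close> is the partner of \<open>(x, u)\<close>:
      \<open>v\<close> is the label of the unique arrow from \<open>y\<close> back to
      \<open>x\<close>.\<close>
    define y where "y = f (x, u)"
    define v where "v = sigma U f y x"
    have y: "y \<in> X" using f x u by (auto simp: y_def)
    have xy: "(x, y) \<in> uniquely_accessible X U f"
      using True by (simp add: regular_set_def y_def)
    then have yx: "(y, x) \<in> uniquely_accessible X U f"
      using sym_uniquely_accessible[OF sym diag] by (auto dest: symD)
    have v: "v \<in> U" "f (y, v) = x"
      using sigma_works[OF yx] by (simp_all add: v_def)
    \<comment> \<open>Regularity of the partner ensures that the second application also takes the
      \<open>sigma\<close> branch. It returns \<open>sigma U f x y\<close>, the only label from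
      \<open>x\<close> to \<open>y\<close>, which is the original \<open>u\<close>.\<close>
    have "(y, v) \<in> regular_set X U f"
      using y v yx by (simp add: regular_set_def)
    moreover have "sigma U f x y = u"
      using sigma_equality[OF xy u] by (simp add: y_def)
    moreover have "?H (x, u) = (y, v)"
      using True by (simp add: canonical_g_def y_def v_def)
    ultimately show ?thesis
      using y v by (simp add: canonical_g_def)
  next
    case False
    \<comment> \<open>The label \<open>u\<close> itself witnesses accessibility, so only uniqueness
      can fail; such a pair lies on the diagonal. The default value \<open>u\<close> of
      \<open>canonical_g\<close> then makes \<open>(x, u)\<close> a fixed point.\<close>
    have "(x, f (x, u)) \<in> accessible X U f - uniquely_accessible X U f"
      using False f x u by (auto simp: regular_set_def accessible_def)
    with diag have "f (x, u) = x" by blast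
    with False x u show ?thesis by (simp add: canonical_g_def)
  qed
  then show ?thesis by (auto simp: involution_on_def)
qed

lemma involution_eq_canonical_g:
  assumes sym: "sym (accessible X U f)"
    and diag: "accessible X U f - uniquely_accessible X U f \<subseteq> Id_on X"
    and g: "involution_on (X \<times> U) (\<lambda>p. (f p, g p))"
    and p: "p \<in> regular_set X U f"
  shows "g p = canonical_g X U f p"
proof -
  obtain x u where p_eq: "p = (x, u)" and xu: "x \<in> X" "u \<in> U"
    and "(x, f (x, u)) \<in> uniquely_accessible X U f"
    using p by (auto simp: regular_set_def)
  then have "(f (x, u), x) \<in> uniquely_accessible X U f"
    using sym_uniquely_accessible[OF sym diag] by (auto dest: symD)
  \<comment> \<open>The equation is the first component of the involution identity at
    \<open>(x, u)\<close>. It makes \<open>g (x, u)\<close> a label from \<open>f (x, u)\<close>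
    back to \<open>x\<close>, so uniqueness identifies it with \<open>sigma\<close>.\<close>
  moreover have "g (x, u) \<in> U" "x = f (f (x, u), g (x, u))"
    using g xu by (auto simp: involution_on_def)
  ultimately have "sigma U f (f (x, u)) x = g (x, u)"
    by (rule sigma_equality)
  with p show ?thesis by (simp add: canonical_g_def p_eq)
qed

theorem proposition1:
  fixes X :: "'x set" and U :: "'u set" and f :: "'x \<times> 'u \<Rightarrow> 'x"
  assumes "f \<in> X \<times> U \<rightarrow> X"
    and "sym (accessible X U f)"
    and "accessible X U f - uniquely_accessible X U f \<subseteq> Id_on X"
  shows "involution_on (X \<times> U) (\<lambda>p. (f p, canonical_g X U f p)) \<and>
    (\<forall>g :: 'x \<times> 'u \<Rightarrow> 'u. g \<in> X \<times> U \<rightarrow> U \<longrightarrow> involution_on (X \<times> U) (\<lambda>p. (f p, g p)) \<longrightarrow>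
      restrict g (regular_set X U f) = restrict (canonical_g X U f) (regular_set X U f))"
  using involution_on_canonical_g[OF assms] involution_eq_canonical_g[OF assms(2,3)]
  by (auto intro!: restrict_ext)

end
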